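(* Let $k$ be a nonnegative integer and let $n=\lfloor 1+\log_2(k+1)\rfloor$. Then for every $g\ge 1$, the $k$-power domination number of the pseudofractal scale-free web $\mathcal{G}_g$ is $$\gamma_{P,k}(\mathcal{G}_g)=\begin{cases}\dfrac{3^{g-n-1}+3}{2}, & g\ge n+1,\\[2mm] 1, & g\le n.\end{cases}$$
   Context: Pseudofractal scale-free web: $\mathcal{G}_1$ is a triangle; for $g\ge1$, $\mathcal{G}_{g+1}$ is obtained from $\mathcal{G}_g$ by adding, for every edge $uv$ of $\mathcal{G}_g$, a new vertex adjacent to exactly $u$ and $v$. For a graph $G$, nonnegative integer $k$ and $D\subseteq V(G)$: $P^0_{G,k}(D)=N_G[D]$ (closed neighborhood of $D$), $P^{i+1}_{G,k}(D)=\bigcup\{N_G[v]: v\in P^i_{G,k}(D),\ |N_G[v]\setminus P^i_{G,k}(D)|\le k\}$; the increasing sequence stabilizes at $P^\infty_{G,k}(D)$. $D$ is a $k$-power dominating set if $P^\infty_{G,k}(D)=V(G)$; $\gamma_{P,k}(G)$ is the minimum size of such a set. The paper writes $n=[1+\log_2(k+1)]$ with $[\cdot]$ the integer part. *)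

theory Defs
  imports Complex_Main
begin

text \<open>A finite simple graph is given by its vertex set \<open>V\<close> and its set \<open>E\<close> of edges,
  each edge being a two-element subset of \<open>V\<close>.\<close>

definition closed_nbhd :: "'v set \<Rightarrow> 'v set set \<Rightarrow> 'v \<Rightarrow> 'v set" where
  "closed_nbhd V E v = insert v {u \<in> V. {u, v} \<in> E}"

primrec power_iter :: "'v set \<Rightarrow> 'v set set \<Rightarrow> nat \<Rightarrow> 'v set \<Rightarrow> nat \<Rightarrow> 'v set" where
  "power_iter V E k D 0 = (\<Union>v\<in>D. closed_nbhd V E v)"
| "power_iter V E k D (Suc i) =
     \<Union> {closed_nbhd V E v | v.
          v \<in> power_iter V E k D i \<and> card (closed_nbhd V E v - power_iter V E k D i) \<le> k}"

text \<open>The sequence is increasing and, in a finite graph, stabilizes; both facts are proved below,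
  so the union is the value at which it stabilizes.\<close>

definition power_limit :: "'v set \<Rightarrow> 'v set set \<Rightarrow> nat \<Rightarrow> 'v set \<Rightarrow> 'v set" where
  "power_limit V E k D = (\<Union>i. power_iter V E k D i)"

definition power_dominating :: "'v set \<Rightarrow> 'v set set \<Rightarrow> nat \<Rightarrow> 'v set \<Rightarrow> bool" where
  "power_dominating V E k D \<longleftrightarrow> D \<subseteq> V \<and> power_limit V E k D = V"

definition power_dom_number :: "'v set \<Rightarrow> 'v set set \<Rightarrow> nat \<Rightarrow> nat" where
  "power_dom_number V E k = Min (card ` {D. power_dominating V E k D})"

text \<open>\<open>pseudofractal g V E\<close> says that \<open>(V, E)\<close> is a copy of \<open>\<G>\<^sub>g\<close>; the construction determines
  the graph only up to the names of the vertices. In the step, \<open>w e\<close> is the new vertex attached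
  to the edge \<open>e\<close>.\<close>

inductive pseudofractal :: "nat \<Rightarrow> 'v set \<Rightarrow> 'v set set \<Rightarrow> bool" where
  triangle: "pseudofractal 1 V {e. e \<subseteq> V \<and> card e = 2}" if "card V = 3"
| step: "pseudofractal (Suc g) (V \<union> w ` E) (E \<union> {{w e, x} | e x. e \<in> E \<and> x \<in> e})"
    if "pseudofractal g V E" and "inj_on w E" and "w ` E \<inter> V = {}"

lemma pseudofractal_finite:
  assumes "pseudofractal g V E"
  shows "finite V \<and> finite E \<and> (\<forall>e\<in>E. e \<subseteq> V \<and> card e = 2)"
  using assms
proof induction
  case (triangle V)
  then have "finite V"
    by (metis card.infinite zero_neq_numeral)
  then show ?case
    by auto
next
  case (step g V E w)
  have "{{w e, x} | e x. e \<in> E \<and> x \<in> e} = (\<Union>e\<in>E. \<Union>x\<in>e. {{w e, x}})"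
    by auto
  moreover have "\<forall>e\<in>E. finite e"
    using step.IH finite_subset by blast
  ultimately have "finite {{w e, x} | e x. e \<in> E \<and> x \<in> e}"
    using step.IH by simp
  moreover have "{w e, x} \<subseteq> V \<union> w ` E \<and> card {w e, x} = 2" if "e \<in> E" "x \<in> e" for e x
  proof -
    have "w e \<noteq> x"
      using step that by blast
    then show ?thesis
      using step.IH that by auto
  qed
  ultimately show ?case
    using step.IH by blast
qed

lemma pseudofractal_exists:
  assumes "infinite (UNIV :: 'v set)" and "1 \<le> g"
  shows "\<exists>(V :: 'v set) E. pseudofractal g V E"
  using \<open>1 \<le> g\<close>
proof (induction g rule: dec_induct)
  case base
  obtain V :: "'v set" where "card V = 3"
    using infinite_arbitrarily_large[OF assms(1)] by blast
  then show ?case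
    using pseudofractal.triangle by blast
next
  case (step g)
  then obtain V :: "'v set" and E where VE: "pseudofractal g V E"
    by blast
  then have fin: "finite V" "finite E"
    using pseudofractal_finite by blast+
  then have "infinite (UNIV - V)"
    using assms(1) by (simp add: Diff_infinite_finite)
  then obtain W where W: "W \<subseteq> UNIV - V" "finite W" "card W = card E"
    using infinite_arbitrarily_large by metis
  then obtain w where "bij_betw w E W"
    using fin by (metis finite_same_card_bij)
  then have "inj_on w E" "w ` E \<inter> V = {}"
    using W by (auto simp: bij_betw_def)
  then show ?case
    using pseudofractal.step[OF VE] by blast
qed

lemma power_iter_incseq: "incseq (power_iter V E k D)"
proof (rule incseq_SucI)
  fix i
  show "power_iter V E k D i \<subseteq> power_iter V E k D (Suc i)"
  proof (induction i)
    case 0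
    show ?case
    proof
      fix u assume "u \<in> power_iter V E k D 0"
      then obtain v where v: "v \<in> D" "u \<in> closed_nbhd V E v"
        by auto
      have "closed_nbhd V E v - power_iter V E k D 0 = {}"
        using v by auto
      then have "card (closed_nbhd V E v - power_iter V E k D 0) \<le> k"
        by (metis card.empty le0)
      moreover have "v \<in> power_iter V E k D 0"
        using v by (auto simp: closed_nbhd_def)
      ultimately show "u \<in> power_iter V E k D (Suc 0)"
        using v unfolding power_iter.simps(2) by blast
    qed
  next
    case (Suc i)
    show ?case
    proof
      fix u assume "u \<in> power_iter V E k D (Suc i)"
      then obtain v where v: "v \<in> power_iter V E k D i" "u \<in> closed_nbhd V E v"
          "card (closed_nbhd V E v - power_iter V E k D i) \<le> k"
        by auto
      then have sub: "closed_nbhd V E v \<subseteq> power_iter V E k D (Suc i)"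
        by auto
      then have "card (closed_nbhd V E v - power_iter V E k D (Suc i)) \<le> k"
        by (metis Diff_eq_empty_iff card.empty le0)
      moreover have "v \<in> power_iter V E k D (Suc i)"
        using Suc v(1) by blast
      ultimately show "u \<in> power_iter V E k D (Suc (Suc i))"
        using v(2) unfolding power_iter.simps(2)[of V E k D "Suc i"] by blast
    qed
  qed
qed

lemma power_iter_subset:
  assumes "D \<subseteq> V"
  shows "power_iter V E k D i \<subseteq> V"
  using assms by (induction i) (auto simp: closed_nbhd_def)

lemma power_iter_stabilizes:
  assumes "finite V" and "D \<subseteq> V"
  shows "\<exists>N. \<forall>i\<ge>N. power_iter V E k D i = power_limit V E k D"
proof -
  have "finite (power_limit V E k D)"
    using assms power_iter_subset[OF assms(2)] finite_subset
    unfolding power_limit_def by (metis UN_least)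
  moreover have "\<forall>x\<in>power_limit V E k D. \<exists>i. x \<in> power_iter V E k D i"
    by (auto simp: power_limit_def)
  then obtain f where f: "\<forall>x\<in>power_limit V E k D. x \<in> power_iter V E k D (f x)"
    by metis
  ultimately have "f x \<le> Max (f ` power_limit V E k D)" if "x \<in> power_limit V E k D" for x
    using that by simp
  then have "power_limit V E k D \<subseteq> power_iter V E k D i"
    if "Max (f ` power_limit V E k D) \<le> i" for i
    using that f incseqD[OF power_iter_incseq] by (meson order_trans subsetD subsetI)
  then show ?thesis
    by (auto simp: power_limit_def)
qed

lemma power_dominating_verts:
  assumes "finite V"
  shows "power_dominating V E k V"
proof -
  have "V \<subseteq> power_iter V E k V 0"
    by (auto simp: closed_nbhd_def)
  then have "V \<subseteq> power_limit V E k V"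
    unfolding power_limit_def by blast
  then show ?thesis
    using power_iter_subset[of V V E k]
    by (auto simp: power_dominating_def power_limit_def)
qed

end

theory Submission
  imports Defs
begin

text \<open>Fix \<open>n\<close> as in the theorem, so that \<open>2 ^ n \<le> 2 * (k + 1)\<close> and \<open>k + 1 < 2 ^ n\<close>. It is convenient
  to start the construction one step earlier, with a single edge \<open>\<G>\<^sub>0\<close>. Consider what grows from
  an edge \<open>e\<close> of \<open>\<G>\<^sub>m\<close> in the last \<open>n\<close> steps, \<open>m = g - n\<close>.

  If one end of \<open>e\<close> lies in \<open>D\<close>, then everything grown from \<open>e\<close> gets observed, because
  \<open>2 ^ (n - 1) - 1 \<le> k\<close>. So the vertices of \<open>\<G>\<^bsub>m-1\<^esub>\<close>, which cover all edges of \<open>\<G>\<^sub>m\<close>, form a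
  \<open>k\<close>-power dominating set; for \<open>g \<le> n\<close> one end of the edge \<open>\<G>\<^sub>0\<close> suffices. Conversely, \<open>D\<close> must
  contain an end of \<open>e\<close> or a vertex grown from \<open>e\<close>, as each end has \<open>2 ^ n - 1 > k\<close> neighbours among
  the latter. Moving the vertices of \<open>D\<close> to ends of the corresponding edges turns \<open>D\<close> into a vertex
  cover of \<open>\<G>\<^sub>m\<close>, and such a cover has at least as many elements as \<open>\<G>\<^bsub>m-1\<^esub>\<close> has vertices.\<close>

section \<open>The webs built from a single edge, and their size\<close>

definition simple_graph :: "'v set \<Rightarrow> 'v set set \<Rightarrow> bool" where
  "simple_graph V E \<longleftrightarrow> finite V \<and> (\<forall>e\<in>E. e \<subseteq> V \<and> card e = 2)"

definition attach :: "'v set set \<Rightarrow> ('v set \<Rightarrow> 'v) \<Rightarrow> 'v set set" where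
  "attach E w = E \<union> {{w e, x} | e x. e \<in> E \<and> x \<in> e}"

inductive web :: "nat \<Rightarrow> 'v set \<Rightarrow> 'v set set \<Rightarrow> bool" where
  edge: "web 0 {x, y} {{x, y}}" if "x \<noteq> y"
| step: "web (Suc g) (V \<union> w ` E) (attach E w)"
    if "web g V E" and "inj_on w E" and "w ` E \<inter> V = {}"

lemma simple_graph_edgeE:
  assumes "simple_graph V E" "e \<in> E" "x \<in> e"
  obtains y where "e = {x, y}" "y \<noteq> x" "x \<in> V" "y \<in> V"
proof -
  have "card e = 2" "e \<subseteq> V"
    using assms by (auto simp: simple_graph_def)
  then show ?thesis
    using assms(3) that by (auto simp: card_2_iff)
qed

lemma simple_graph_finite_edges: "simple_graph V E \<Longrightarrow> finite E"
  unfolding simple_graph_def by (rule finite_subset[of _ "Pow V"]) auto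

lemma simple_graph_finite_edge: "simple_graph V E \<Longrightarrow> e \<in> E \<Longrightarrow> finite e"
  unfolding simple_graph_def by (meson finite_subset)

lemma simple_graph_edge_nonempty:
  assumes "simple_graph V E" "e \<in> E"
  obtains x where "x \<in> e"
proof -
  have "e \<noteq> {}"
    using assms by (auto simp: simple_graph_def)
  then show ?thesis
    using that by blast
qed

lemma simple_graph_edge_eqI:
  assumes "simple_graph V E" "simple_graph V' E'" "e \<in> E" "f \<in> E'" "e \<subseteq> f"
  shows "e = f"
proof (rule card_subset_eq)
  show "finite f"
    using assms(2,4) by (rule simple_graph_finite_edge)
qed (use assms in \<open>auto simp: simple_graph_def\<close>)

lemma simple_graph_attach:
  assumes "simple_graph V E" "w ` E \<inter> V = {}"
  shows "simple_graph (V \<union> w ` E) (attach E w)"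
proof -
  have "card {w e, x} = 2" if "e \<in> E" "x \<in> e" for e x
  proof -
    have "w e \<noteq> x"
      using assms that by (auto simp: simple_graph_def)
    then show ?thesis
      by simp
  qed
  then show ?thesis
    using assms simple_graph_finite_edges[OF assms(1)]
    by (auto simp: simple_graph_def attach_def)
qed

lemma web_simple_graph: "web g V E \<Longrightarrow> simple_graph V E"
proof (induction rule: web.induct)
  case (edge x y)
  then show ?case
    by (auto simp: simple_graph_def)
next
  case (step g V E w)
  then show ?case
    by (auto intro: simple_graph_attach)
qed

text \<open>No vertex is isolated, so observing all edges observes all vertices, and every vertex
  has an incident edge to choose.\<close>

lemma web_Union: "web g V E \<Longrightarrow> \<Union> E = V"
proof (induction rule: web.induct)
  case (step g V E w)
  have sg: "simple_graph V E"
    using step.hyps(1) by (rule web_simple_graph)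
  have "w ` E \<subseteq> \<Union> (attach E w)"
  proof (rule image_subsetI)
    fix e assume e: "e \<in> E"
    obtain x where "x \<in> e"
      using simple_graph_edge_nonempty[OF sg e] .
    then have "{w e, x} \<in> attach E w"
      using e by (auto simp: attach_def)
    then show "w e \<in> \<Union> (attach E w)"
      by blast
  qed
  moreover have "V \<subseteq> \<Union> (attach E w)"
    using step.IH by (auto simp: attach_def)
  moreover have "\<Union> (attach E w) \<subseteq> V \<union> w ` E"
    using simple_graph_attach[OF sg step.hyps(3)] by (auto simp: simple_graph_def)
  ultimately show ?case
    by blast
qed simp

text \<open>The triangle is the first step applied to the edge \<open>{x, y}\<close>, with
  \<open>z\<close> as the vertex attached to it.\<close>

lemma pseudofractal_imp_web: "pseudofractal g V E \<Longrightarrow> web g V E"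
proof (induction rule: pseudofractal.induct)
  case (triangle V)
  then obtain x y z where V: "V = {x, y, z}" "x \<noteq> y" "y \<noteq> z" "x \<noteq> z"
    by (auto simp: card_3_iff)
  have "web (Suc 0) ({x, y} \<union> (\<lambda>_. z) ` {{x, y}}) (attach {{x, y}} (\<lambda>_. z))"
    using V by (intro web.step web.edge) auto
  moreover have "attach {{x, y}} (\<lambda>_. z) = {{x, y}, {z, x}, {z, y}}"
    by (auto simp: attach_def)
  moreover have "{e. e \<subseteq> V \<and> card e = 2} = {{x, y}, {z, x}, {z, y}}"
    using V by (auto simp: card_2_iff)
  moreover have "{x, y} \<union> (\<lambda>_. z) ` {{x, y}} = V"
    using V by auto
  ultimately show ?case
    by simp
next
  case (step g V E w)
  then show ?case
    using web.step[of g V E w] by (simp add: attach_def)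
qed

text \<open>The new edges correspond to the incidences \<open>(e, x)\<close>, two for each edge:
  injectivity of \<open>w\<close> recovers \<open>e\<close> from the new end.\<close>

lemma card_attach:
  assumes "simple_graph V E" "inj_on w E" "w ` E \<inter> V = {}"
  shows "card (attach E w) = 3 * card E"
proof -
  define A where "A = (SIGMA e:E. e)"
  define h where "h = (\<lambda>(e, x). {w e, x})"
  have fin: "finite E" "\<forall>e\<in>E. finite e"
    using assms(1) simple_graph_finite_edges simple_graph_finite_edge by blast+
  have new: "w e \<noteq> x" if "e \<in> E" "e' \<in> E" "x \<in> e'" for e e' x
    using assms that by (auto simp: simple_graph_def)
  have "card A = 2 * card E"
    using fin assms(1) by (simp add: A_def simple_graph_def)
  moreover have "inj_on h A"
  proof (rule inj_onI)
    fix p q assume pq: "p \<in> A" "q \<in> A" "h p = h q"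
    obtain e x e' x' where p: "p = (e, x)" "q = (e', x')"
      by fastforce
    then have *: "e \<in> E" "x \<in> e" "e' \<in> E" "x' \<in> e'" "{w e, x} = {w e', x'}"
      using pq by (auto simp: A_def h_def)
    then have "w e = w e'" "x = x'"
      using new by (metis doubleton_eq_iff)+
    then show "p = q"
      using p * assms(2) by (auto simp: inj_on_def)
  qed
  moreover have "finite A"
    using fin by (simp add: A_def)
  moreover have "E \<inter> h ` A = {}"
    using new by (fastforce simp: A_def h_def)
  moreover have "attach E w = E \<union> h ` A"
    by (force simp: attach_def A_def h_def)
  ultimately show ?thesis
    using fin by (simp add: card_Un_disjoint card_image)
qed

lemma web_card: "web g V E \<Longrightarrow> card E = 3 ^ g \<and> 2 * card V = 3 ^ g + 3"
proof (induction rule: web.induct)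
  case (step g V E w)
  have sg: "simple_graph V E"
    using step.hyps web_simple_graph by blast
  then have "card (V \<union> w ` E) = card V + card E"
    using step.hyps simple_graph_finite_edges[OF sg]
    by (subst card_Un_disjoint) (auto simp: card_image simple_graph_def)
  then show ?case
    using step.IH card_attach[OF sg step.hyps(2,3)] by simp
qed simp

section \<open>Tracing edges back through the construction\<close>

text \<open>An old edge survives the step and counts as its own parent, so \<open>e = {x, y}\<close>
  has the three children \<open>e\<close>, \<open>{w e, x}\<close> and
  \<open>{w e, y}\<close>.\<close>

definition parent :: "'v set set \<Rightarrow> ('v set \<Rightarrow> 'v) \<Rightarrow> 'v set \<Rightarrow> 'v set" where
  "parent E w f = (if f \<in> E then f else (THE e. e \<in> E \<and> w e \<in> f))"

lemma parent_old: "f \<in> E \<Longrightarrow> parent E w f = f"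
  by (simp add: parent_def)

lemma parent_new:
  assumes "simple_graph V E" "inj_on w E" "w ` E \<inter> V = {}" "e \<in> E" "x \<in> e"
  shows "parent E w {w e, x} = e"
proof -
  have "x \<in> V"
    using assms by (auto simp: simple_graph_def)
  moreover have "{w e, x} \<notin> E"
    using assms(1,3,4) unfolding simple_graph_def by blast
  moreover have "(THE e'. e' \<in> E \<and> w e' \<in> {w e, x}) = e"
    using assms \<open>x \<in> V\<close> by (intro the_equality) (auto simp: inj_on_def)
  ultimately show ?thesis
    by (simp add: parent_def)
qed

lemma parent_cases:
  assumes "simple_graph V E" "inj_on w E" "w ` E \<inter> V = {}" "f \<in> attach E w"
  obtains (old) "f \<in> E" "parent E w f = f"
  | (new) e x where "e \<in> E" "x \<in> e" "f = {w e, x}" "parent E w f = e"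
  using assms parent_new[OF assms(1-3)] parent_old[of f E w] unfolding attach_def by blast

text \<open>In \<open>lineage r V\<^sub>0 E\<^sub>0 V E L\<close>, the graph \<open>(V, E)\<close> arises from \<open>(V\<^sub>0, E\<^sub>0)\<close> by \<open>r\<close> steps of the
  construction, and \<open>L\<close> sends every edge of \<open>E\<close> to the edge of \<open>E\<^sub>0\<close> from which it has grown.\<close>

inductive lineage ::
  "nat \<Rightarrow> 'v set \<Rightarrow> 'v set set \<Rightarrow> 'v set \<Rightarrow> 'v set set \<Rightarrow> ('v set \<Rightarrow> 'v set) \<Rightarrow> bool" where
  refl: "lineage 0 V E V E (\<lambda>f. f)"
| step: "lineage (Suc r) V\<^sub>0 E\<^sub>0 V E (\<lambda>f. parent E\<^sub>0 w (L f))"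
    if "inj_on w E\<^sub>0" and "w ` E\<^sub>0 \<inter> V\<^sub>0 = {}"
      and "lineage r (V\<^sub>0 \<union> w ` E\<^sub>0) (attach E\<^sub>0 w) V E L"

text \<open>\<open>lineage\<close> adds steps at its base, so the induction moves the base back from
  stage \<open>Suc m\<close> to stage \<open>m\<close>; hence \<open>m\<close> is
  generalised.\<close>

lemma web_lineage:
  assumes "web (m + r) V E"
  shows "\<exists>V\<^sub>0 E\<^sub>0 L. web m V\<^sub>0 E\<^sub>0 \<and> lineage r V\<^sub>0 E\<^sub>0 V E L"
  using assms
proof (induction r arbitrary: m)
  case 0
  then show ?case
    using lineage.refl by fastforce
next
  case (Suc r)
  then obtain V\<^sub>1 E\<^sub>1 L where 1: "web (Suc m) V\<^sub>1 E\<^sub>1" "lineage r V\<^sub>1 E\<^sub>1 V E L"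
    by (metis add_Suc_shift)
  from 1(1) obtain V\<^sub>0 E\<^sub>0 w where 0: "web m V\<^sub>0 E\<^sub>0" "inj_on w E\<^sub>0" "w ` E\<^sub>0 \<inter> V\<^sub>0 = {}"
    "V\<^sub>1 = V\<^sub>0 \<union> w ` E\<^sub>0" "E\<^sub>1 = attach E\<^sub>0 w"
    by (auto elim: web.cases)
  have "lineage (Suc r) V\<^sub>0 E\<^sub>0 V E (\<lambda>f. parent E\<^sub>0 w (L f))"
    using 0(2,3) 1(2) unfolding 0(4,5) by (rule lineage.step)
  then show ?case
    using 0(1) by blast
qed

lemma lineage_base:
  assumes "lineage r V\<^sub>0 E\<^sub>0 V E L"
  shows "V\<^sub>0 \<subseteq> V" "E\<^sub>0 \<subseteq> E"
  using assms by (induction rule: lineage.induct) (auto simp: attach_def)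

lemma lineage_simple_graph:
  assumes "lineage r V\<^sub>0 E\<^sub>0 V E L" "simple_graph V\<^sub>0 E\<^sub>0"
  shows "simple_graph V E"
  using assms by (induction rule: lineage.induct) (auto intro: simple_graph_attach)

text \<open>Passing from a new edge \<open>{w e, x}\<close> to its parent loses only
  \<open>w e\<close>, which is not in \<open>V\<^sub>0\<close>.\<close>

lemma lineage_edge:
  assumes "lineage r V\<^sub>0 E\<^sub>0 V E L" "simple_graph V\<^sub>0 E\<^sub>0" "f \<in> E"
  shows "L f \<in> E\<^sub>0 \<and> f \<inter> V\<^sub>0 \<subseteq> L f"
  using assms
proof (induction rule: lineage.induct)
  case (refl V E)
  then show ?case by simp
next
  case (step w E\<^sub>0 V\<^sub>0 r V E L)
  have 1: "L f \<in> attach E\<^sub>0 w" "f \<inter> (V\<^sub>0 \<union> w ` E\<^sub>0) \<subseteq> L f"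
    using step simple_graph_attach by blast+
  from step.prems(1) step.hyps(1,2) 1(1) show ?case
  proof (cases rule: parent_cases)
    case old
    then show ?thesis
      using 1 by auto
  next
    case (new e x)
    then show ?thesis
      using 1(2) step.hyps(2) by auto
  qed
qed

text \<open>Later steps add no edge between old vertices: \<open>f\<close> lies inside its ancestor,
  and both have two elements.\<close>

lemma lineage_fixed:
  assumes "lineage r V\<^sub>0 E\<^sub>0 V E L" "simple_graph V\<^sub>0 E\<^sub>0" "f \<in> E" "f \<subseteq> V\<^sub>0"
  shows "L f = f"
proof -
  have "L f \<in> E\<^sub>0" "f \<subseteq> L f"
    using lineage_edge[OF assms(1-3)] assms(4) by auto
  then show ?thesis
    using simple_graph_edge_eqI[OF lineage_simple_graph[OF assms(1,2)] assms(2,3)] by metis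
qed

text \<open>Every edge at \<open>w e\<close> comes from an edge \<open>{w e, y}\<close>, whose
  parent is \<open>e\<close>; for vertices added later the induction hypothesis applies.\<close>

lemma lineage_unique:
  assumes "lineage r V\<^sub>0 E\<^sub>0 V E L" "simple_graph V\<^sub>0 E\<^sub>0"
    and "f \<in> E" "f' \<in> E" "x \<in> f" "x \<in> f'" "x \<notin> V\<^sub>0"
  shows "L f = L f'"
  using assms
proof (induction rule: lineage.induct)
  case (refl V E)
  then show ?case by (auto simp: simple_graph_def)
next
  case (step w E\<^sub>0 V\<^sub>0 r V E L)
  let ?V = "V\<^sub>0 \<union> w ` E\<^sub>0"
  have sg: "simple_graph ?V (attach E\<^sub>0 w)"
    using step.prems(1) step.hyps(2) by (rule simple_graph_attach)
  show ?case
  proof (cases "x \<in> ?V")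
    case False
    then show ?thesis
      using step sg by simp
  next
    case True
    then obtain e where e: "e \<in> E\<^sub>0" "x = w e"
      using step.prems by auto
    have "parent E\<^sub>0 w (L h) = e" if "h \<in> E" "x \<in> h" for h
    proof -
      have 1: "L h \<in> attach E\<^sub>0 w" "x \<in> L h"
        using lineage_edge[OF step.hyps(3) sg that(1)] that(2) True by auto
      from step.prems(1) step.hyps(1,2) 1(1) show ?thesis
      proof (cases rule: parent_cases)
        case old
        then show ?thesis
          using 1(2) step.prems by (auto simp: simple_graph_def)
      next
        case (new e' y)
        then have "y \<in> V\<^sub>0"
          using step.prems by (auto simp: simple_graph_def)
        then show ?thesis
          using new 1(2) e step.prems(6) step.hyps(1) by (auto simp: inj_on_def)
      qed
    qed
    then show ?thesis
      using step.prems by simp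
  qed
qed

text \<open>Of the three children of \<open>e\<close>, exactly \<open>e\<close> and
  \<open>{w e, x}\<close> contain \<open>x\<close>, so the count doubles with each step.\<close>

lemma lineage_degree:
  assumes "lineage r V\<^sub>0 E\<^sub>0 V E L" "simple_graph V\<^sub>0 E\<^sub>0" "e \<in> E\<^sub>0" "x \<in> e"
  shows "card {u. {u, x} \<in> E \<and> L {u, x} = e} = 2 ^ r"
  using assms
proof (induction arbitrary: e rule: lineage.induct)
  case (refl V E)
  then obtain y where "e = {x, y}" "y \<noteq> x"
    by (metis simple_graph_edgeE)
  then have "{u. {u, x} \<in> E \<and> {u, x} = e} = {y}"
    using refl by (auto simp: doubleton_eq_iff insert_commute)
  then show ?case
    by simp
next
  case (step w E\<^sub>0 V\<^sub>0 r V E L)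
  let ?V = "V\<^sub>0 \<union> w ` E\<^sub>0"
  let ?U = "\<lambda>e. {u. {u, x} \<in> E \<and> L {u, x} = e}"
  have sg: "simple_graph ?V (attach E\<^sub>0 w)"
    using step.prems(1) step.hyps(2) by (rule simple_graph_attach)
  have x: "x \<in> V\<^sub>0"
    using step.prems by (auto simp: simple_graph_def)
  have new: "e \<in> attach E\<^sub>0 w" "{w e, x} \<in> attach E\<^sub>0 w"
    using step.prems by (auto simp: attach_def)
  have "{u. {u, x} \<in> E \<and> parent E\<^sub>0 w (L {u, x}) = e} = ?U e \<union> ?U {w e, x}"
  proof (intro equalityI subsetI)
    fix u assume u: "u \<in> {u. {u, x} \<in> E \<and> parent E\<^sub>0 w (L {u, x}) = e}"
    then have 1: "L {u, x} \<in> attach E\<^sub>0 w" "x \<in> L {u, x}"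
      using lineage_edge[OF step.hyps(3) sg, of "{u, x}"] x by auto
    from step.prems(1) step.hyps(1,2) 1(1) show "u \<in> ?U e \<union> ?U {w e, x}"
    proof (cases rule: parent_cases)
      case old
      then show ?thesis
        using u by auto
    next
      case (new e' y)
      then have "e' = e"
        using u by auto
      moreover have "x \<noteq> w e'"
        using x new(1) step.hyps(2) by auto
      then have "y = x"
        using 1(2) unfolding new(3) by simp
      ultimately have "L {u, x} = {w e, x}"
        using new(3) by simp
      then show ?thesis
        using u by simp
    qed
  next
    fix u assume u: "u \<in> ?U e \<union> ?U {w e, x}"
    then have "parent E\<^sub>0 w (L {u, x}) = e"
      using parent_new[OF step.prems(1) step.hyps(1,2) step.prems(2,3)]
        parent_old[OF step.prems(2), of w] by (elim UnE CollectE conjE) simp_all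
    then show "u \<in> {u. {u, x} \<in> E \<and> parent E\<^sub>0 w (L {u, x}) = e}"
      using u by auto
  qed
  moreover have card_U: "card (?U e) = 2 ^ r" "card (?U {w e, x}) = 2 ^ r"
    using step.IH[OF sg new(1)] step.IH[OF sg new(2)] step.prems by auto
  moreover have "finite (?U e)" "finite (?U {w e, x})"
    by (rule card_ge_0_finite, simp add: card_U)+
  moreover have "{w e, x} \<noteq> e"
    using step.prems step.hyps(2) by (auto simp: simple_graph_def)
  then have "?U e \<inter> ?U {w e, x} = {}"
    by auto
  ultimately show ?case
    by (simp add: card_Un_disjoint)
qed

section \<open>Upper bound: covers of the base graph observe everything\<close>

lemma closed_nbhd_eq:
  assumes "simple_graph V E"
  shows "closed_nbhd V E v = insert v {u. {u, v} \<in> E}"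
  using assms by (auto simp: closed_nbhd_def simple_graph_def)

text \<open>Let \<open>x\<close> be a vertex of \<open>e\<close> whose whole neighbourhood is observed. The vertex \<open>a\<close> attached to
  \<open>e = {x, y}\<close> is then observed, and by induction so is everything grown from \<open>{x, a}\<close>. The
  unobserved neighbours of \<open>a\<close> have hence grown from \<open>{y, a}\<close>, so that there are at most
  \<open>2 ^ (r - 1) - 1\<close> of them and \<open>a\<close> propagates.\<close>

lemma lineage_observed:
  assumes "lineage r V\<^sub>0 E\<^sub>0 V E L" "simple_graph V\<^sub>0 E\<^sub>0"
    and closed: "\<And>v. v \<in> S \<Longrightarrow> card (closed_nbhd V E v - S) \<le> k \<Longrightarrow> closed_nbhd V E v \<subseteq> S"
    and "2 ^ r \<le> 2 * (k + 1)"
    and "e \<in> E\<^sub>0" "e \<subseteq> S" "x \<in> e" "closed_nbhd V E x \<subseteq> S" "f \<in> E" "L f = e"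
  shows "f \<subseteq> S"
  using assms
proof (induction arbitrary: e f x rule: lineage.induct)
  case (refl V E)
  then show ?case by simp
next
  case (step w E\<^sub>0 V\<^sub>0 r V E L)
  let ?V = "V\<^sub>0 \<union> w ` E\<^sub>0"
  define a where "a = w e"
  note sg0 = step.prems(1)
  have sg1: "simple_graph ?V (attach E\<^sub>0 w)"
    using step.prems(1) step.hyps(2) by (rule simple_graph_attach)
  have sg: "simple_graph V E"
    using lineage_simple_graph[OF step.hyps(3) sg1] .
  obtain y where y: "e = {x, y}" "y \<noteq> x" "x \<in> V\<^sub>0" "y \<in> V\<^sub>0"
    using simple_graph_edgeE[OF sg0 step.prems(4,6)] .
  have edges1: "{a, x} \<in> attach E\<^sub>0 w" "{a, y} \<in> attach E\<^sub>0 w" "e \<in> attach E\<^sub>0 w"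
    using step.prems y by (auto simp: attach_def a_def)
  then have edges: "{a, x} \<in> E" "{a, y} \<in> E"
    using lineage_base[OF step.hyps(3)] by auto
  have aS: "a \<in> S"
    using step.prems(7) edges(1) by (auto simp: closed_nbhd_eq[OF sg])
  have a: "a \<in> ?V" "a \<notin> V\<^sub>0"
    using step.prems step.hyps(2) by (auto simp: a_def)
  \<comment> \<open>Halving the bound for \<open>Suc r\<close> gives what \<open>a\<close> needs in
    order to propagate, and more than the induction hypothesis asks for.\<close>
  have r: "2 ^ r \<le> k + 1"
    using step.prems(3) by simp
  note IH = step.IH[OF sg1 step.prems(2)]
  have below_x: "h \<subseteq> S" if "h \<in> E" "L h = {a, x}" for h
    using IH[of "{a, x}" x h] r edges1 aS step.prems(5,7) y that by auto
  have below: "L h \<in> {e, {a, x}, {a, y}}" if h: "h \<in> E" "parent E\<^sub>0 w (L h) = e" for h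
  proof -
    have 1: "L h \<in> attach E\<^sub>0 w"
      using lineage_edge[OF step.hyps(3) sg1 h(1)] by simp
    from sg0 step.hyps(1,2) 1 show ?thesis
      by (cases rule: parent_cases) (use h y in \<open>auto simp: a_def\<close>)
  qed
  have a_full: "closed_nbhd V E a \<subseteq> S"
  proof (rule step.prems(2)[OF aS])
    let ?U = "{u. {u, a} \<in> E \<and> L {u, a} = {a, y}}"
    have card_U: "card ?U = 2 ^ r"
      using lineage_degree[OF step.hyps(3) sg1 edges1(2)] by simp
    then have fin: "finite ?U"
      by (intro card_ge_0_finite) simp
    \<comment> \<open>The observed vertex \<open>y\<close> is one of these \<open>2 ^ r\<close>
      neighbours, which leaves at most \<open>2 ^ r - 1 \<le> k\<close> unobserved.\<close>
    have "L {a, y} = {a, y}"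
      using lineage_fixed[OF step.hyps(3) sg1 edges(2)] a y by auto
    then have yU: "y \<in> ?U"
      using edges by (auto simp: insert_commute)
    have "closed_nbhd V E a - S \<subseteq> ?U - {y}"
    proof
      fix u assume "u \<in> closed_nbhd V E a - S"
      then have u: "{u, a} \<in> E" "u \<notin> S"
        using aS by (auto simp: closed_nbhd_eq[OF sg])
      have 1: "L {u, a} \<in> attach E\<^sub>0 w" "a \<in> L {u, a}"
        using lineage_edge[OF step.hyps(3) sg1 u(1)] a by auto
      \<comment> \<open>Seen from the base \<open>V\<^sub>0\<close>, the vertex \<open>a\<close> is
        new, so all edges at \<open>a\<close> have the ancestor \<open>e\<close>.\<close>
      have par: "lineage (Suc r) V\<^sub>0 E\<^sub>0 V E (\<lambda>f. parent E\<^sub>0 w (L f))"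
        using step.hyps by (rule lineage.step)
      have "parent E\<^sub>0 w (L {u, a}) = parent E\<^sub>0 w (L {a, x})"
        using lineage_unique[OF par sg0 u(1) edges(1), of a] a by auto
      also have "L {a, x} = {a, x}"
        using lineage_fixed[OF step.hyps(3) sg1 edges(1)] a y by auto
      also have "parent E\<^sub>0 w {a, x} = e"
        unfolding a_def using parent_new[OF sg0 step.hyps(1,2)] step.prems by auto
      finally have "L {u, a} \<in> {e, {a, x}, {a, y}}"
        using below u by simp
      moreover have "L {u, a} \<noteq> e"
        using 1(2) a y by auto
      moreover have "L {u, a} \<noteq> {a, x}"
        using below_x u by auto
      moreover have "u \<noteq> y"
        using u step.prems(5) y by auto
      ultimately show "u \<in> ?U - {y}"
        using u by auto
    qed
    then have "card (closed_nbhd V E a - S) \<le> card (?U - {y})"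
      using fin by (intro card_mono) auto
    also have "\<dots> = 2 ^ r - 1"
      using card_U yU fin by simp
    finally show "card (closed_nbhd V E a - S) \<le> k"
      using r by linarith
  qed
  consider "L f = e" | "L f = {a, x}" | "L f = {a, y}"
    using below step.prems by auto
  then show ?case
  proof cases
    case 1
    then show ?thesis
      using IH[of e x f] r edges1 step.prems by auto
  next
    case 2
    then show ?thesis
      using below_x step.prems by simp
  next
    case 3
    \<comment> \<open>Now \<open>a\<close> plays the part of \<open>x\<close>, its neighbourhood
      being observed.\<close>
    then show ?thesis
      using IH[of "{a, y}" a f] r edges1 aS a_full step.prems y by auto
  qed
qed

text \<open>At an index where the sequence is stable, the next step adds nothing. This supplies
  \<open>closed\<close> in \<open>lineage_observed\<close>.\<close>

lemma power_limit_closed: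
  assumes "finite V" "D \<subseteq> V" "v \<in> power_limit V E k D"
    and "card (closed_nbhd V E v - power_limit V E k D) \<le> k"
  shows "closed_nbhd V E v \<subseteq> power_limit V E k D"
proof -
  obtain N where N: "\<And>i. i \<ge> N \<Longrightarrow> power_iter V E k D i = power_limit V E k D"
    using power_iter_stabilizes[OF assms(1,2)] by blast
  have "closed_nbhd V E v \<subseteq> power_iter V E k D (Suc N)"
    using assms(3,4) N[of N] by auto
  then show ?thesis
    using N[of "Suc N"] by simp
qed

lemma closed_nbhd_subset_power_limit:
  assumes "v \<in> D"
  shows "closed_nbhd V E v \<subseteq> power_limit V E k D"
proof -
  have "closed_nbhd V E v \<subseteq> power_iter V E k D 0"
    using assms by auto
  then show ?thesis
    unfolding power_limit_def by blast
qed

text \<open>In every base edge some end lies in \<open>D\<close>, so its neighbourhood, the other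
  end included, is observed at once and \<open>lineage_observed\<close> applies.\<close>

lemma power_dominating_cover:
  assumes L: "lineage r V\<^sub>0 E\<^sub>0 V E L" and sg0: "simple_graph V\<^sub>0 E\<^sub>0" and "\<Union> E = V"
    and "2 ^ r \<le> 2 * (k + 1)" and "D \<subseteq> V\<^sub>0" and cover: "\<And>e. e \<in> E\<^sub>0 \<Longrightarrow> e \<inter> D \<noteq> {}"
  shows "power_dominating V E k D"
proof -
  have sg: "simple_graph V E"
    using lineage_simple_graph[OF L sg0] .
  have D: "D \<subseteq> V"
    using assms lineage_base[OF L] by auto
  let ?S = "power_limit V E k D"
  have "f \<subseteq> ?S" if f: "f \<in> E" for f
  proof -
    have e: "L f \<in> E\<^sub>0"
      using lineage_edge[OF L sg0 f] by simp
    then obtain x where x: "x \<in> L f" "x \<in> D"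
      using cover by blast
    then obtain y where y: "L f = {x, y}"
      using simple_graph_edgeE[OF sg0 e] by blast
    have full: "closed_nbhd V E x \<subseteq> ?S"
      using closed_nbhd_subset_power_limit[OF x(2)] .
    have "{y, x} \<in> E"
      using e y lineage_base[OF L] by (auto simp: insert_commute)
    then have "L f \<subseteq> ?S"
      using full y by (auto simp: closed_nbhd_eq[OF sg])
    then show ?thesis
      using lineage_observed[OF L sg0 _ assms(4) e _ x(1) full f]
        power_limit_closed[OF _ D] sg by (auto simp: simple_graph_def)
  qed
  then have "V \<subseteq> ?S"
    using assms(3) by blast
  moreover have "?S \<subseteq> V"
    using power_iter_subset[OF D] by (auto simp: power_limit_def)
  ultimately show ?thesis
    using D by (simp add: power_dominating_def)
qed

section \<open>Lower bound: forts and vertex covers\<close>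

text \<open>To observe the first vertices of \<open>S\<close>, some \<open>v\<close> outside
  \<open>S\<close> must propagate, but at that time all of its more than \<open>k\<close> neighbours
  in \<open>S\<close> are unobserved.\<close>

lemma power_iter_avoids_fort:
  assumes "finite V" "D \<subseteq> V"
    and D: "\<And>v. v \<in> D \<Longrightarrow> closed_nbhd V E v \<inter> S = {}"
    and fort: "\<And>v. v \<in> V - S \<Longrightarrow> closed_nbhd V E v \<inter> S \<noteq> {} \<Longrightarrow> k < card (closed_nbhd V E v \<inter> S)"
  shows "power_iter V E k D i \<inter> S = {}"
proof (induction i)
  case 0
  then show ?case
    using D by auto
next
  case (Suc i)
  have "closed_nbhd V E v \<inter> S = {}"
    if v: "v \<in> power_iter V E k D i" "card (closed_nbhd V E v - power_iter V E k D i) \<le> k" for v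
  proof (rule ccontr)
    assume ne: "closed_nbhd V E v \<inter> S \<noteq> {}"
    have "v \<in> V - S"
      using v Suc power_iter_subset[OF assms(2)] by blast
    then have "k < card (closed_nbhd V E v \<inter> S)"
      using fort ne by blast
    also have "\<dots> \<le> card (closed_nbhd V E v - power_iter V E k D i)"
      using assms(1) Suc by (intro card_mono) (auto simp: closed_nbhd_def)
    finally show False
      using v by simp
  qed
  then show ?case
    by auto
qed

definition grown :: "'v set \<Rightarrow> 'v set set \<Rightarrow> ('v set \<Rightarrow> 'v set) \<Rightarrow> 'v set \<Rightarrow> 'v set" where
  "grown V\<^sub>0 E L e = {v. v \<notin> V\<^sub>0 \<and> (\<exists>f\<in>E. v \<in> f \<and> L f = e)}"

text \<open>The vertices grown from an edge \<open>e\<close> have only the ends of \<open>e\<close> as outside neighbours, and each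
  end has \<open>2 ^ r - 1 > k\<close> neighbours among them, so it can never propagate into them.\<close>

lemma power_dominating_meets_grown:
  assumes L: "lineage r V\<^sub>0 E\<^sub>0 V E L" and sg0: "simple_graph V\<^sub>0 E\<^sub>0"
    and r: "k + 1 < 2 ^ r" and dom: "power_dominating V E k D" and e: "e \<in> E\<^sub>0"
  shows "D \<inter> (e \<union> grown V\<^sub>0 E L e) \<noteq> {}"
proof
  assume D0: "D \<inter> (e \<union> grown V\<^sub>0 E L e) = {}"
  let ?S = "grown V\<^sub>0 E L e"
  have sg: "simple_graph V E"
    using lineage_simple_graph[OF L sg0] .
  have boundary: "v \<in> e" if v: "v \<notin> ?S" "closed_nbhd V E v \<inter> ?S \<noteq> {}" for v
  proof -
    obtain u where u: "u \<in> ?S" "{u, v} \<in> E"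
      using v by (auto simp: closed_nbhd_eq[OF sg])
    then obtain f where f: "f \<in> E" "u \<in> f" "L f = e" "u \<notin> V\<^sub>0"
      by (auto simp: grown_def)
    have "L {u, v} = e"
      using lineage_unique[OF L sg0 u(2) f(1), of u] f by simp
    moreover from this have "v \<in> V\<^sub>0"
      using v(1) u by (auto simp: grown_def)
    ultimately show ?thesis
      using lineage_edge[OF L sg0 u(2)] by auto
  qed
  have many: "k < card (closed_nbhd V E v \<inter> ?S)" if v: "v \<in> e" for v
  proof -
    let ?U = "{u. {u, v} \<in> E \<and> L {u, v} = e}"
    obtain y where y: "e = {v, y}" "v \<in> V\<^sub>0"
      using simple_graph_edgeE[OF sg0 e v] .
    \<comment> \<open>Of the \<open>2 ^ r\<close> neighbours in \<open>?U\<close> only the other end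
      \<open>y\<close> can lie in \<open>V\<^sub>0\<close>, because an edge inside
      \<open>V\<^sub>0\<close> is its own ancestor.\<close>
    have "?U - {y} \<subseteq> closed_nbhd V E v \<inter> ?S"
    proof
      fix u assume u: "u \<in> ?U - {y}"
      have "u \<notin> V\<^sub>0"
      proof
        assume "u \<in> V\<^sub>0"
        then have "{u, v} = e"
          using lineage_fixed[OF L sg0, of "{u, v}"] u y by auto
        then show False
          using u y by (auto simp: doubleton_eq_iff)
      qed
      then show "u \<in> closed_nbhd V E v \<inter> ?S"
        using u by (auto simp: grown_def closed_nbhd_eq[OF sg])
    qed
    moreover have "finite (closed_nbhd V E v)"
      using sg by (auto simp: closed_nbhd_def simple_graph_def)
    ultimately have "card (?U - {y}) \<le> card (closed_nbhd V E v \<inter> ?S)"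
      by (intro card_mono) auto
    moreover have "card ?U - 1 \<le> card (?U - {y})"
      by (simp add: card_Diff_singleton_if)
    ultimately show ?thesis
      using lineage_degree[OF L sg0 e v] r by linarith
  qed
  have "finite V" "D \<subseteq> V" and lim: "power_limit V E k D = V"
    using sg dom by (auto simp: simple_graph_def power_dominating_def)
  \<comment> \<open>\<open>D\<close> avoids \<open>e\<close> and \<open>?S\<close>, so by
    \<open>boundary\<close> no closed neighbourhood of a vertex of \<open>D\<close> meets
    \<open>?S\<close>.\<close>
  then have "power_iter V E k D i \<inter> ?S = {}" for i
    using power_iter_avoids_fort[of V D E ?S k i] D0 boundary many by blast
  then have "V \<inter> ?S = {}"
    using lim unfolding power_limit_def by blast
  moreover have "?S \<subseteq> V"
    using sg by (auto simp: grown_def simple_graph_def)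
  moreover obtain v where "v \<in> e"
    using simple_graph_edge_nonempty[OF sg0 e] .
  then have "closed_nbhd V E v \<inter> ?S \<noteq> {}"
    using many by fastforce
  ultimately show False
    by blast
qed

lemma vertex_cover_of_power_dominating:
  assumes L: "lineage r V\<^sub>0 E\<^sub>0 V E L" and sg0: "simple_graph V\<^sub>0 E\<^sub>0"
    and r: "k + 1 < 2 ^ r" and dom: "power_dominating V E k D"
  obtains C where "finite C" "card C \<le> card D" "\<And>e. e \<in> E\<^sub>0 \<Longrightarrow> e \<inter> C \<noteq> {}"
proof
  let ?G = "grown V\<^sub>0 E L"
  \<comment> \<open>All edges at a vertex grown from \<open>e\<close> have the ancestor
    \<open>e\<close>, so whichever \<open>x\<close> is chosen is an end of \<open>e\<close>.\<close>
  define c where "c v = (if v \<in> V\<^sub>0 then v else SOME x. \<exists>f\<in>E. v \<in> f \<and> x \<in> L f)" for v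
  have "finite D"
    using dom lineage_simple_graph[OF L sg0]
    by (auto simp: power_dominating_def simple_graph_def intro: finite_subset)
  then show "finite (c ` D)" "card (c ` D) \<le> card D"
    by (auto intro: card_image_le)
  fix e assume e: "e \<in> E\<^sub>0"
  then obtain v where v: "v \<in> D" "v \<in> e \<union> ?G e"
    using power_dominating_meets_grown[OF L sg0 r dom e] by blast
  have "c v \<in> e"
  proof (cases "v \<in> e")
    case True
    then show ?thesis
      using e sg0 by (auto simp: c_def simple_graph_def)
  next
    case False
    then obtain f where f: "f \<in> E" "v \<in> f" "L f = e" "v \<notin> V\<^sub>0"
      using v by (auto simp: grown_def)
    obtain x where "x \<in> e"
      using simple_graph_edge_nonempty[OF sg0 e] .
    then have "\<exists>x. \<exists>f\<in>E. v \<in> f \<and> x \<in> L f"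
      using f by blast
    from someI_ex[OF this] f(4) obtain h where h: "h \<in> E" "v \<in> h" "c v \<in> L h"
      by (auto simp: c_def)
    then show ?thesis
      using lineage_unique[OF L sg0 h(1) f(1), of v] f by simp
  qed
  then show "e \<inter> c ` D \<noteq> {}"
    using v by blast
qed

text \<open>If \<open>x \<in> V\<close> is missing from the cover \<open>C\<close>, then \<open>C\<close> contains the vertices attached to the edges
  at \<open>x\<close>; as two missing vertices are never adjacent, these replacements are distinct.\<close>

lemma card_vertex_cover_attach:
  assumes sg: "simple_graph V E" and "\<Union> E = V" and w: "inj_on w E" "w ` E \<inter> V = {}"
    and C: "finite C" "\<And>e. e \<in> attach E w \<Longrightarrow> e \<inter> C \<noteq> {}"
  shows "card V \<le> card C"
proof -
  have "\<forall>x\<in>V. \<exists>e\<in>E. x \<in> e"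
    using assms(2) by blast
  then obtain \<epsilon> where \<epsilon>: "\<And>x. x \<in> V \<Longrightarrow> \<epsilon> x \<in> E \<and> x \<in> \<epsilon> x"
    by metis
  define h where "h x = (if x \<in> C then x else w (\<epsilon> x))" for x
  have "h x \<in> C" if "x \<in> V" for x
    using C(2)[of "{w (\<epsilon> x), x}"] \<epsilon>[OF that] by (auto simp: h_def attach_def)
  moreover have "inj_on h V"
  proof (rule inj_onI)
    fix x y assume xy: "x \<in> V" "y \<in> V" "h x = h y"
    have new: "w (\<epsilon> x) \<notin> V" "w (\<epsilon> y) \<notin> V"
      using \<epsilon> xy w(2) by blast+
    show "x = y"
    proof (cases "x \<in> C \<or> y \<in> C")
      case True
      then show ?thesis
        using xy new by (auto simp: h_def split: if_splits)
    next
      case False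
      then have "\<epsilon> x = \<epsilon> y"
        using xy \<epsilon> w(1) by (auto simp: h_def inj_on_def)
      then have e: "\<epsilon> x \<in> E" "x \<in> \<epsilon> x" "y \<in> \<epsilon> x"
        using \<epsilon> xy by auto
      obtain z where "\<epsilon> x = {x, z}"
        using simple_graph_edgeE[OF sg e(1,2)] .
      moreover have "\<epsilon> x \<inter> C \<noteq> {}"
        using C(2) e(1) by (auto simp: attach_def)
      ultimately show ?thesis
        using False e by auto
    qed
  qed
  ultimately show ?thesis
    using C(1) by (intro card_inj_on_le[of h]) auto
qed

section \<open>The two cases of the formula\<close>

lemma power_dom_number_eqI:
  assumes "finite V" "power_dominating V E k D"
    and "\<And>D'. power_dominating V E k D' \<Longrightarrow> card D \<le> card D'"
  shows "power_dom_number V E k = card D"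
  unfolding power_dom_number_def
proof (rule Min_eqI)
  have "{D. power_dominating V E k D} \<subseteq> Pow V"
    by (auto simp: power_dominating_def)
  then show "finite (card ` {D. power_dominating V E k D})"
    using assms(1) finite_subset by blast
qed (use assms in auto)

lemma power_limit_empty: "power_limit V E k {} = {}"
proof -
  have "power_iter V E k {} i = {}" for i
    by (induction i) auto
  then show ?thesis
    by (simp add: power_limit_def)
qed

text \<open>Everything has grown from one edge, and the empty set observes nothing.\<close>

lemma power_dom_number_web_small:
  assumes web: "web r V E" and r: "2 ^ r \<le> 2 * (k + 1)"
  shows "power_dom_number V E k = 1"
proof -
  obtain V\<^sub>0 E\<^sub>0 L where 0: "web 0 V\<^sub>0 E\<^sub>0" and L: "lineage r V\<^sub>0 E\<^sub>0 V E L"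
    using web_lineage[of 0 r V E] web by auto
  obtain x y where xy: "V\<^sub>0 = {x, y}" "E\<^sub>0 = {{x, y}}"
    using 0 by (auto elim: web.cases)
  have fin: "finite V"
    using web_simple_graph[OF web] by (simp add: simple_graph_def)
  have "power_dominating V E k {x}"
    using power_dominating_cover[OF L web_simple_graph[OF 0] web_Union[OF web] r] xy by auto
  moreover have "card {x} \<le> card D" if D: "power_dominating V E k D" for D
  proof -
    have "D \<noteq> {}"
      using D lineage_base[OF L] xy by (auto simp: power_dominating_def power_limit_empty)
    moreover have "finite D"
      using D fin by (auto simp: power_dominating_def intro: finite_subset)
    ultimately show ?thesis
      by (simp add: Suc_le_eq card_gt_0_iff)
  qed
  ultimately show ?thesis
    using power_dom_number_eqI[OF fin] by fastforce
qed

text \<open>The lineage starts at stage \<open>Suc m\<close>; stage \<open>m\<close> before it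
  supplies both the cover and the count, down to \<open>m = 0\<close>, where it is a single
  edge.\<close>

lemma power_dom_number_web_large:
  assumes web: "web (Suc m + r) V E" and r: "2 ^ r \<le> 2 * (k + 1)" "k + 1 < 2 ^ r"
  shows "2 * power_dom_number V E k = 3 ^ m + 3"
proof -
  obtain V\<^sub>1 E\<^sub>1 L where 1: "web (Suc m) V\<^sub>1 E\<^sub>1" and L: "lineage r V\<^sub>1 E\<^sub>1 V E L"
    using web_lineage[OF web] by blast
  from 1 obtain V\<^sub>0 E\<^sub>0 w where 0: "web m V\<^sub>0 E\<^sub>0" and w: "inj_on w E\<^sub>0" "w ` E\<^sub>0 \<inter> V\<^sub>0 = {}"
    and V1: "V\<^sub>1 = V\<^sub>0 \<union> w ` E\<^sub>0" "E\<^sub>1 = attach E\<^sub>0 w"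
    by (auto elim: web.cases)
  note sg0 = web_simple_graph[OF 0] and sg1 = web_simple_graph[OF 1]
  have fin: "finite V"
    using web_simple_graph[OF web] by (simp add: simple_graph_def)
  have "e \<inter> V\<^sub>0 \<noteq> {}" if "e \<in> E\<^sub>1" for e
  proof -
    have "\<And>f. f \<in> E\<^sub>0 \<Longrightarrow> f \<subseteq> V\<^sub>0 \<and> f \<noteq> {}"
      using sg0 by (auto simp: simple_graph_def)
    then show ?thesis
      using that V1(2) unfolding attach_def by blast
  qed
  then have "power_dominating V E k V\<^sub>0"
    using power_dominating_cover[OF L sg1 web_Union[OF web] r(1)] V1 by blast
  moreover have "card V\<^sub>0 \<le> card D" if D: "power_dominating V E k D" for D
  proof -
    obtain C where C: "finite C" "card C \<le> card D" "\<And>e. e \<in> E\<^sub>1 \<Longrightarrow> e \<inter> C \<noteq> {}"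
      using vertex_cover_of_power_dominating[OF L sg1 r(2) D] by blast
    then show ?thesis
      using card_vertex_cover_attach[OF sg0 web_Union[OF 0] w C(1)] V1 by force
  qed
  ultimately have "power_dom_number V E k = card V\<^sub>0"
    using power_dom_number_eqI[OF fin] by blast
  then show ?thesis
    using web_card[OF 0] by simp
qed

text \<open>This is \<open>n - 1 \<le> log 2 (k + 1) < n\<close> exponentiated; the factor 2 avoids
  the exponent \<open>n - 1\<close> on naturals.\<close>

lemma two_power_floor_log_bounds:
  fixes k n :: nat
  assumes "n = nat \<lfloor>1 + log 2 (real k + 1)\<rfloor>"
  shows "2 ^ n \<le> 2 * (k + 1)" "k + 1 < 2 ^ n"
proof -
  \<comment> \<open>A nonnegative logarithm keeps \<open>nat\<close> from truncating the
    floor.\<close>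
  have "log 2 (real k + 1) \<ge> 0"
    by simp
  then have n: "real n \<le> 1 + log 2 (real k + 1)" "1 + log 2 (real k + 1) < real n + 1"
    unfolding assms by linarith+
  have pow: "2 powr log 2 (real k + 1) = real k + 1"
    by simp
  have "2 powr real n \<le> 2 powr (1 + log 2 (real k + 1))"
    using n by (intro powr_mono) auto
  then have "real (2 ^ n) \<le> real (2 * (k + 1))"
    by (simp add: powr_add powr_realpow)
  then show "2 ^ n \<le> 2 * (k + 1)"
    by (simp only: of_nat_le_iff)
  have "2 powr log 2 (real k + 1) < 2 powr real n"
    using n by (intro powr_less_mono) auto
  then have "real (k + 1) < real (2 ^ n)"
    by (simp add: powr_realpow)
  then show "k + 1 < 2 ^ n"
    by (simp only: of_nat_less_iff)
qed

theorem theorem1: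
  fixes k n g :: nat and V :: "'v set" and E :: "'v set set"
  assumes "n = nat \<lfloor>1 + log 2 (real k + 1)\<rfloor>"
    and "g \<ge> 1"
    and "pseudofractal g V E"
  shows "real (power_dom_number V E k) =
    (if g \<ge> n + 1 then (3 ^ (g - n - 1) + 3) / 2 else 1)"
proof -
  note n = two_power_floor_log_bounds[OF assms(1)]
  have web: "web g V E"
    using assms(3) by (rule pseudofractal_imp_web)
  show ?thesis
  proof (cases "g \<ge> n + 1")
    case True
    then have "g = Suc (g - n - 1) + n"
      by simp
    then have "2 * power_dom_number V E k = 3 ^ (g - n - 1) + 3"
      using power_dom_number_web_large[of "g - n - 1" n] web n by simp
    then have "real (2 * power_dom_number V E k) = real (3 ^ (g - n - 1) + 3)"
      by simp
    then show ?thesis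
      using True by simp
  next
    case False
    \<comment> \<open>Since \<open>g \<le> n\<close>, the bound for \<open>n\<close> also holds for
      \<open>g\<close>, the number of steps from the single edge.\<close>
    then have "(2::nat) ^ g \<le> 2 ^ n"
      by (intro power_increasing) auto
    then have "2 ^ g \<le> 2 * (k + 1)"
      using n(1) by (rule order_trans)
    then show ?thesis
      using power_dom_number_web_small[OF web] False by simp
  qed
qed

end
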